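(* Let $\alpha>-2$, $\beta>-1$ be real numbers and let $n$ be a nonnegative integer. Then $${\cal P}_{n0}^{(\alpha,\beta)}(x)=P_{0n}^{(\alpha+1,\beta)}(x),$$ that is, the alternative Jacobi polynomial with $k=0$ equals the shifted Jacobi polynomial $P_{n}^{(\alpha+1,\beta)}(1-2x)$.
   Context: For integers $0\le k\le n$ and real $\alpha,\beta$, the alternative Jacobi polynomials are given by $${\cal P}_{nk}^{(\alpha,\beta)}(x)=\frac{x^{-\alpha-k-1}(1-x)^{-\beta}}{(n-k)!}\frac{d^{\,n-k}}{dx^{\,n-k}}\left(x^{\alpha+n+k+1}(1-x)^{\beta+n-k}\right),\qquad 0<x<1$$ (here this formula is used for $\alpha>-2$, $\beta>-1$). The shifted Jacobi polynomials are $P_{0n}^{(\alpha,\beta)}(x)=P_n^{(\alpha,\beta)}(1-2x)$, where $P_n^{(\alpha,\beta)}$ denotes the classical Jacobi polynomial in its standard (Szeg\H{o}) normalization; for $\alpha,\beta>-1$ they are orthogonal on $[0,1]$ with weight $x^\alpha(1-x)^\beta$. *)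

theory Defs
  imports "HOL-Computational_Algebra.Polynomial" "HOL-Analysis.Analysis"
begin

text \<open>
  Classical Jacobi polynomial, by its explicit (terminating hypergeometric) form
  \<open>P\<^sub>n(y) = (a+1)\<^sub>n / n! * \<^sub>2F\<^sub>1(-n, n+a+b+1; a+1; (1-y)/2)\<close>
  with the denominators \<open>(a+1)\<^sub>j\<close> cancelled (Szego, Orthogonal Polynomials, (4.21.2)).
\<close>

definition jacobi_poly :: "nat \<Rightarrow> real \<Rightarrow> real \<Rightarrow> real poly" where
  "jacobi_poly n a b =
     smult (1 / fact n)
       (\<Sum>j\<le>n. smult (real (n choose j) * pochhammer (real n + a + b + 1) j
                        * pochhammer (a + real j + 1) (n - j))
                 ([:- 1 / 2, 1 / 2:] ^ j))"

text \<open>Szego's normalization.\<close>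

lemma poly_jacobi_poly_1: "poly (jacobi_poly n a b) 1 = (real n + a) gchoose n"
proof -
  have "poly (jacobi_poly n a b) 1 =
      (\<Sum>j\<le>n. if j = 0 then pochhammer (a + 1) n else 0) / fact n"
    unfolding jacobi_poly_def by (auto simp: poly_sum intro!: sum.cong)
  also have "\<dots> = pochhammer (a + 1) n / fact n"
    by simp
  also have "\<dots> = (real n + a) gchoose n"
    by (simp add: gbinomial_pochhammer' add.commute)
  finally show ?thesis .
qed

definition shifted_jacobi :: "nat \<Rightarrow> real \<Rightarrow> real \<Rightarrow> real \<Rightarrow> real" where
  "shifted_jacobi n a b x = poly (jacobi_poly n a b) (1 - 2 * x)"

text \<open>Only meaningful for \<open>k \<le> n\<close> and \<open>0 < x < 1\<close>.\<close>

definition alt_jacobi :: "nat \<Rightarrow> nat \<Rightarrow> real \<Rightarrow> real \<Rightarrow> real \<Rightarrow> real" where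
  "alt_jacobi n k a b x =
     x powr (- a - real k - 1) * (1 - x) powr (- b) / fact (n - k) *
     (deriv ^^ (n - k))
       (\<lambda>t. t powr (a + real n + real k + 1) * (1 - t) powr (b + real n - real k)) x"

end

theory Submission imports Defs begin

text \<open>
  With \<open>a = \<alpha> + 1\<close>, the Leibniz rule applied to the Rodrigues formula gives
  \<open>\<Sum>\<^sub>k (a + n gchoose n - k) (\<beta> + n gchoose k) (-x)\<^sup>k (1 - x)\<^sup>n\<^sup>-\<^sup>k\<close>. Expanding the powers of \<open>1 - x\<close>,
  trinomial revision followed by Vandermonde's convolution yields the coefficients of the
  hypergeometric form.
\<close>

text \<open>The Leibniz rule, for derivatives divided by factorials so that no binomial coefficients
  appear: \<open>F k\<close> stands for \<open>f\<^sup>(\<^sup>k\<^sup>) / k!\<close>.\<close>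

lemma higher_deriv_mult_divided:
  fixes F G :: "nat \<Rightarrow> 'a :: real_normed_field \<Rightarrow> 'a"
  assumes "open S"
    and F: "\<And>k t. t \<in> S \<Longrightarrow> (F k has_field_derivative of_nat (Suc k) * F (Suc k) t) (at t)"
    and G: "\<And>k t. t \<in> S \<Longrightarrow> (G k has_field_derivative of_nat (Suc k) * G (Suc k) t) (at t)"
    and "t \<in> S"
  shows "(deriv ^^ m) (\<lambda>t. F 0 t * G 0 t) t = fact m * (\<Sum>k\<le>m. F k t * G (m - k) t)"
  using \<open>t \<in> S\<close>
proof (induction m arbitrary: t)
  case 0
  then show ?case by simp
next
  case (Suc m)
  let ?H = "\<lambda>m t. \<Sum>k\<le>m. F k t * G (m - k) t"
  \<comment> \<open>Both sums can be extended to \<open>Suc m\<close> for free: after the index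
    shift the new term \<open>k = 0\<close> has weight 0 here, and in the next sum the new term
    \<open>k = Suc m\<close> does.\<close>
  have "(\<Sum>k\<le>m. of_nat (Suc k) * F (Suc k) t * G (m - k) t)
      = (\<Sum>k\<le>Suc m. of_nat k * F k t * G (Suc m - k) t)"
    by (simp add: sum.atMost_Suc_shift del: sum.atMost_Suc of_nat_Suc)
  moreover have "(\<Sum>k\<le>m. of_nat (Suc (m - k)) * G (Suc (m - k)) t * F k t)
      = (\<Sum>k\<le>Suc m. of_nat (Suc m - k) * G (Suc m - k) t * F k t)"
    by (simp add: Suc_diff_le del: of_nat_Suc of_nat_diff)
  ultimately have "(\<Sum>k\<le>m. of_nat (Suc k) * F (Suc k) t * G (m - k) t
        + of_nat (Suc (m - k)) * G (Suc (m - k)) t * F k t)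
      = (\<Sum>k\<le>Suc m. of_nat k * F k t * G (Suc m - k) t
        + of_nat (Suc m - k) * G (Suc m - k) t * F k t)"
    by (simp only: sum.distrib)
  \<comment> \<open>The weights \<open>k\<close> and \<open>Suc m - k\<close> of each product add up
    to \<open>Suc m\<close>.\<close>
  also have "\<dots> = of_nat (Suc m) * ?H (Suc m) t"
    unfolding sum_distrib_left
    by (intro sum.cong refl) (simp add: of_nat_diff algebra_simps del: of_nat_Suc)
  finally have *: "(\<Sum>k\<le>m. of_nat (Suc k) * F (Suc k) t * G (m - k) t
        + of_nat (Suc (m - k)) * G (Suc (m - k)) t * F k t)
      = of_nat (Suc m) * ?H (Suc m) t" .
  have "(?H m has_field_derivative of_nat (Suc m) * ?H (Suc m) t) (at t)"
    unfolding *[symmetric] by (intro DERIV_sum DERIV_mult F G Suc.prems)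
  then have "((\<lambda>t. fact m * ?H m t) has_field_derivative
      fact m * (of_nat (Suc m) * ?H (Suc m) t)) (at t)"
    by (rule DERIV_cmult)
  \<comment> \<open>The induction hypothesis identifies the two functions only on \<open>S\<close>;
    openness of \<open>S\<close> lets the derivative at \<open>t\<close> carry over.\<close>
  then have "((deriv ^^ m) (\<lambda>t. F 0 t * G 0 t) has_field_derivative
      fact m * (of_nat (Suc m) * ?H (Suc m) t)) (at t)"
    by (rule has_field_derivative_transform_within_open[OF _ \<open>open S\<close> \<open>t \<in> S\<close>])
       (simp add: Suc.IH)
  then show ?case
    by (simp add: DERIV_imp_deriv mult.assoc mult.left_commute del: of_nat_Suc sum.atMost_Suc)
qed

text \<open>Absorption, (k+1) (A choose k+1) = (A - k) (A choose k), absorbs the exponent brought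
  down by differentiation. This makes the divided derivatives of a real power a family of the kind
  that \<open>higher_deriv_mult_divided\<close> takes.\<close>

lemma has_real_derivative_gbinomial_powr:
  fixes A t :: real
  assumes "t > 0"
  shows "((\<lambda>t. (A gchoose k) * t powr (A - real k)) has_real_derivative
    real (Suc k) * ((A gchoose Suc k) * t powr (A - real (Suc k)))) (at t)"
proof -
  have "real (Suc k) * (A gchoose Suc k) = (A gchoose k) * (A - real k)"
    using gbinomial_mult_1'[of A k] by (simp add: right_diff_distrib mult.commute)
  then have "real (Suc k) * ((A gchoose Suc k) * t powr (A - real (Suc k)))
      = (A gchoose k) * (A - real k) * t powr (A - real (Suc k))"
    by (simp only: mult.assoc[symmetric])
  then have "real (Suc k) * ((A gchoose Suc k) * t powr (A - real (Suc k)))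
      = (A gchoose k) * ((A - real k) * t powr (A - real k - 1))"
    by (simp add: mult.assoc diff_diff_eq add.commute)
  then show ?thesis
    using DERIV_cmult[OF has_real_derivative_powr[OF assms, of "A - real k"]] by metis
qed

lemma pochhammer_eq_fact_gbinomial:
  fixes z :: "'a :: field_char_0"
  shows "pochhammer z k = fact k * (z + of_nat k - 1 gchoose k)"
  by (simp add: gbinomial_pochhammer')

lemma sum_triangle_swap:
  fixes g :: "nat \<Rightarrow> nat \<Rightarrow> 'a :: comm_monoid_add"
  shows "(\<Sum>k\<le>n. \<Sum>j\<in>{k..n}. g k j) = (\<Sum>j\<le>n. \<Sum>k\<le>j. g k j)"
proof -
  have "(\<Sum>k\<le>n. \<Sum>j\<in>{k..n}. g k j) = (\<Sum>k\<le>n. \<Sum>j\<in>{j \<in> {..n}. k \<le> j}. g k j)"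
    by (intro sum.cong) auto
  also have "\<dots> = (\<Sum>j\<le>n. \<Sum>k\<in>{k \<in> {..n}. k \<le> j}. g k j)"
    by (intro sum.swap_restrict) auto
  also have "\<dots> = (\<Sum>j\<le>n. \<Sum>k\<le>j. g k j)"
    by (intro sum.cong) auto
  finally show ?thesis .
qed

lemma sum_gbinomial_mult_power_one_minus:
  fixes A B x :: "'a :: field_char_0"
  shows "(\<Sum>k\<le>n. (A gchoose (n - k)) * (B gchoose k) * (- x) ^ k * (1 - x) ^ (n - k))
    = (\<Sum>j\<le>n. (A + B - of_nat n + of_nat j gchoose j) * (A gchoose (n - j)) * (- x) ^ j)"
proof -
  have "(\<Sum>k\<le>n. (A gchoose (n - k)) * (B gchoose k) * (- x) ^ k * (1 - x) ^ (n - k))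
      = (\<Sum>k\<le>n. \<Sum>j\<in>{k..n}. (A gchoose (n - k)) * (B gchoose k) *
            of_nat ((n - k) choose (n - j)) * (- x) ^ j)"
  proof (intro sum.cong refl)
    fix k assume "k \<in> {..n}"
    \<comment> \<open>The lower index \<open>n - j\<close>, in place of \<open>j - k\<close>, is the
      form to which trinomial revision applies below.\<close>
    have choose_eq: "(n - k) choose (n - (k + i)) = (n - k) choose i" if "i \<le> n - k" for i
      using binomial_symmetric[OF that] by simp
    have "(1 - x) ^ (n - k) = (\<Sum>i\<le>n - k. of_nat ((n - k) choose i) * (- x) ^ i)"
      using binomial_ring[of "- x" 1 "n - k"] by simp
    then have "(- x) ^ k * (1 - x) ^ (n - k)
        = (\<Sum>i\<le>n - k. of_nat ((n - k) choose i) * (- x) ^ (k + i))"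
      by (simp add: sum_distrib_left power_add mult_ac)
    also have "\<dots> = (\<Sum>j\<in>{k..n}. of_nat ((n - k) choose (n - j)) * (- x) ^ j)"
      using \<open>k \<in> {..n}\<close>
      by (intro sum.reindex_bij_witness[of _ "\<lambda>j. j - k" "\<lambda>i. k + i"])
         (auto simp: choose_eq)
    finally show "(A gchoose (n - k)) * (B gchoose k) * (- x) ^ k * (1 - x) ^ (n - k)
        = (\<Sum>j\<in>{k..n}. (A gchoose (n - k)) * (B gchoose k) *
            of_nat ((n - k) choose (n - j)) * (- x) ^ j)"
      by (simp add: sum_distrib_left mult.assoc)
  qed
  also have "\<dots> = (\<Sum>j\<le>n. \<Sum>k\<le>j. (A gchoose (n - k)) * (B gchoose k) *
            of_nat ((n - k) choose (n - j)) * (- x) ^ j)"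
    by (rule sum_triangle_swap)
  also have "\<dots> = (\<Sum>j\<le>n. \<Sum>k\<le>j. (B gchoose k) * (A - of_nat (n - j) gchoose (j - k)) *
            ((A gchoose (n - j)) * (- x) ^ j))"
  proof (intro sum.cong refl)
    fix j k assume jk: "j \<in> {..n}" "k \<in> {..j}"
    \<comment> \<open>After the revision \<open>A gchoose (n - j)\<close> is free of
      \<open>k\<close>, and since (n-k) - (n-j) = j - k the remaining sum over \<open>k\<close> is a
      Vandermonde convolution.\<close>
    then have "(A gchoose (n - k)) * of_nat ((n - k) choose (n - j))
        = (A gchoose (n - j)) * (A - of_nat (n - j) gchoose (j - k))"
      using gbinomial_trinomial_revision[of "n - j" "n - k" A]
      by (simp add: binomial_gbinomial)
    moreover have "(A gchoose (n - k)) * (B gchoose k) *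
            of_nat ((n - k) choose (n - j)) * (- x) ^ j
        = (A gchoose (n - k)) * of_nat ((n - k) choose (n - j)) * ((B gchoose k) * (- x) ^ j)"
      by (simp only: mult_ac)
    ultimately show "(A gchoose (n - k)) * (B gchoose k) *
            of_nat ((n - k) choose (n - j)) * (- x) ^ j
        = (B gchoose k) * (A - of_nat (n - j) gchoose (j - k)) *
            ((A gchoose (n - j)) * (- x) ^ j)"
      by (simp only: mult_ac)
  qed
  also have "\<dots> = (\<Sum>j\<le>n. (A + B - of_nat n + of_nat j gchoose j) * (A gchoose (n - j)) * (- x) ^ j)"
  proof (intro sum.cong refl)
    fix j assume "j \<in> {..n}"
    then have "B + (A - of_nat (n - j)) = A + B - of_nat n + of_nat j"
      by (simp add: of_nat_diff)
    then show "(\<Sum>k\<le>j. (B gchoose k) * (A - of_nat (n - j) gchoose (j - k)) *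
            ((A gchoose (n - j)) * (- x) ^ j))
        = (A + B - of_nat n + of_nat j gchoose j) * (A gchoose (n - j)) * (- x) ^ j"
      by (simp only: gbinomial_Vandermonde[unfolded atLeast0AtMost] mult.assoc[of "_ gchoose j"] flip: sum_distrib_right)
  qed
  finally show ?thesis .
qed

text \<open>At y = 1 - 2x the base (y - 1)/2 becomes -x, and (n choose j)/n! = 1/(j! (n-j)!) cancels
  exactly the factorials that appear when the two Pochhammer symbols are written as binomial
  coefficients.\<close>

lemma shifted_jacobi_eq_sum_gbinomial:
  "shifted_jacobi n a b x =
    (\<Sum>j\<le>n. (real n + a + b + real j gchoose j) * (a + real n gchoose (n - j)) * (- x) ^ j)"
proof -
  have "poly [:- 1 / 2, 1 / 2:] (1 - 2 * x) = - x"
    by (simp add: field_simps)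
  then have "shifted_jacobi n a b x = (\<Sum>j\<le>n. real (n choose j) *
      pochhammer (real n + a + b + 1) j * pochhammer (a + real j + 1) (n - j) * (- x) ^ j / fact n)"
    by (simp add: shifted_jacobi_def jacobi_poly_def poly_sum sum_divide_distrib)
  also have "\<dots> =
    (\<Sum>j\<le>n. (real n + a + b + real j gchoose j) * (a + real n gchoose (n - j)) * (- x) ^ j)"
    by (intro sum.cong refl)
       (simp add: pochhammer_eq_fact_gbinomial binomial_fact of_nat_diff add_ac)
  finally show ?thesis .
qed

theorem mainTheorem4:
  fixes \<alpha> \<beta> x :: real and n :: nat
  assumes "\<alpha> > -2" and "\<beta> > -1" and "0 < x" and "x < 1"
  shows "alt_jacobi n 0 \<alpha> \<beta> x = shifted_jacobi n (\<alpha> + 1) \<beta> x"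
proof -
  \<comment> \<open>The exponents of t and 1 - t under the derivative in the Rodrigues formula with
    k = 0.\<close>
  define A B where "A = \<alpha> + 1 + real n" and "B = \<beta> + real n"
  \<comment> \<open>\<open>F k\<close> and \<open>G k\<close> are the k-th derivatives of (1-t)^B
    and t^A divided by k!; the sign in \<open>F\<close> comes from the inner derivative -1.\<close>
  define F where "F = (\<lambda>(k::nat) t. (B gchoose k) * (- 1 :: real) ^ k * (1 - t) powr (B - real k))"
  define G where "G = (\<lambda>(k::nat) t. (A gchoose k) * t powr (A - real k))"
  have F: "(F k has_real_derivative real (Suc k) * F (Suc k) t) (at t)"
    if "t \<in> {0<..<1}" for k t
  proof -
    have "((\<lambda>t. 1 - t) has_real_derivative - 1) (at t)"
      by (auto intro!: derivative_eq_intros)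
    from DERIV_cmult[OF DERIV_chain2[OF has_real_derivative_gbinomial_powr[of "1 - t" B k] this],
        of "(- 1) ^ k"]
    show ?thesis
      using that by (simp add: F_def algebra_simps)
  qed
  have G: "(G k has_real_derivative real (Suc k) * G (Suc k) t) (at t)"
    if "t \<in> {0<..<1}" for k t
    unfolding G_def using that by (intro has_real_derivative_gbinomial_powr) simp
  \<comment> \<open>On the open unit interval both bases t and 1 - t are positive, so the rule for
    real powers covers both families.\<close>
  have "(deriv ^^ n) (\<lambda>t. F 0 t * G 0 t) x = fact n * (\<Sum>k\<le>n. F k x * G (n - k) x)"
    using assms by (intro higher_deriv_mult_divided[of "{0<..<1}"] F G) auto
  moreover have "(\<lambda>t. F 0 t * G 0 t) =
      (\<lambda>t. t powr (\<alpha> + real n + real 0 + 1) * (1 - t) powr (\<beta> + real n - real 0))"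
    by (simp add: F_def G_def A_def B_def fun_eq_iff add_ac mult.commute)
  ultimately have "alt_jacobi n 0 \<alpha> \<beta> x =
      x powr (- \<alpha> - 1) * (1 - x) powr (- \<beta>) * (\<Sum>k\<le>n. F k x * G (n - k) x)"
    by (simp add: alt_jacobi_def)
  also have "\<dots> = (\<Sum>k\<le>n. (A gchoose (n - k)) * (B gchoose k) * (- x) ^ k * (1 - x) ^ (n - k))"
    unfolding sum_distrib_left
  proof (intro sum.cong refl)
    fix k assume k: "k \<in> {..n}"
    \<comment> \<open>The prefactors cancel the non-integral parts of the exponents: A - (n-k) -
      \<alpha> - 1 = k and B - k - \<beta> = n - k, leaving natural powers.\<close>
    have "x powr (- \<alpha> - 1) * x powr (A - real (n - k)) = x ^ k"
      using assms k by (simp add: A_def of_nat_diff powr_realpow flip: powr_add)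
    moreover have "(1 - x) powr (- \<beta>) * (1 - x) powr (B - real k) = (1 - x) ^ (n - k)"
      using assms k by (simp add: B_def powr_realpow flip: powr_add of_nat_diff)
    moreover have "x powr (- \<alpha> - 1) * (1 - x) powr (- \<beta>) * (F k x * G (n - k) x) =
        (A gchoose (n - k)) * (B gchoose k) * (- 1) ^ k *
        (x powr (- \<alpha> - 1) * x powr (A - real (n - k))) *
        ((1 - x) powr (- \<beta>) * (1 - x) powr (B - real k))"
      by (simp add: F_def G_def)
    ultimately show "x powr (- \<alpha> - 1) * (1 - x) powr (- \<beta>) * (F k x * G (n - k) x) =
        (A gchoose (n - k)) * (B gchoose k) * (- x) ^ k * (1 - x) ^ (n - k)"
      by (simp add: power_minus[of x])
  qed
  also have "\<dots> = shifted_jacobi n (\<alpha> + 1) \<beta> x"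
    \<comment> \<open>The upper arguments agree because A + B - n + j = n + (\<alpha> + 1) + \<beta>
      + j.\<close>
    unfolding sum_gbinomial_mult_power_one_minus shifted_jacobi_eq_sum_gbinomial
    by (intro sum.cong refl) (simp add: A_def B_def algebra_simps)
  finally show ?thesis .
qed

end
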